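(* Let $(\mathcal F,\partial,\int)$ be an ordinary shifted integro-differential algebra over an ordered field $K$. Then $(\mathcal D\mathcal F,D,I)$, with the shifts $\mathsf S_c$, is an ordinary shifted integro-differential module over $\mathcal F$. Its shifted Rota-Baxter operators $I_b:=(1-\mathsf E_b)I$ $(b\in K)$ satisfy, for $f\in\mathcal F$ and $a\in K$, the recursion $$I_b(f\delta_a^{(k)})=\begin{cases}\mathsf e_a(f)\,I_b\delta_a&\text{for }k=0,\\ f\delta_a^{(k-1)}-I_b(f'\delta_a^{(k-1)})&\text{for }k>0,\end{cases}$$ with base case $I_b\delta_a=H_a-\bar H(a-b)=H(a-b)-\bar H_a$.
   Context: All algebras are commutative and unital; $[P,Q]=PQ-QP$. **Heaviside operator.** $H\colon K\to K$ is $H(a)=0$ for $a\le 0$ and $H(a)=1$ for $a>0$; $\bar H(a)=1-H(a)$. **Integro-differential algebra.** $(\mathcal F,\partial,\int)$ is a differential $K$-algebra with a $K$-linear map $\int$ such that $\partial\int=1$ and $f\int g=\int fg+\int(f'\int g)$. It is ordinary if $\ker\partial=K$; then $\mathsf e:=1-\int\partial$ is a $K$-algebra homomorphism $\mathcal F\to K$. It is shifted if there is a group homomorphism $S\colon(K,+)\to\operatorname{Aut}_K(\mathcal F)$, $c\mapsto S_c$, with $[S_c,\int]=\mathsf e_c\int$ and $[S_c,\partial]=0$, where $\mathsf e_c:=\mathsf e\circ S_c$. Set $\int_c:=(1-\mathsf e_c)\int$, $\int_c^d:=\mathsf e_d\int_c$. **Distribution module.** Let $\mathcal F\{H_a\mid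 a\in K\}_1$ be the free $\mathcal F$-module on $1$ and all $H_a^{(k)}$ $(a\in K,k\ge 0)$, with derivation extending $\partial$, sending $H_a^{(k)}\mapsto H_a^{(k+1)}$ and obeying the Leibniz rule over $\mathcal F$. Put $\delta_a:=H_a'$, $\bar H_a:=1-H_a$, and let $Z$ be the differential $\mathcal F$-submodule generated by all $f\delta_a-\mathsf e_a(f)\delta_a$. Then $\mathcal D\mathcal F:=\mathcal F\{H_a\mid a\in K\}_1/Z$, $D$ is the induced derivation, and $I$ is the (well-defined) $K$-linear map with $$I(f)=\int f,\quad I(fH_a)=\Big(\int_af\Big)H_a+\bar H(a)\int_0^af,$$ $$I(f\delta_a)=\mathsf e_a(f)\big(H_a-\bar H(a)\big),\quad I(f\delta_a^{(k)})=f\delta_a^{(k-1)}-I(f'\delta_a^{(k-1)})\ (k>0).$$ Put $\mathsf E:=1-I D$ on $\mathcal D\mathcal F$. The shifts on $\mathcal D\mathcal F$ are the $K$-linear maps $\mathsf S_c$ with $\mathsf S_c(f)=S_c(f)$ and $\mathsf S_c(fH_a^{(k)})=S_c(f)\,H_{a-c}^{(k)}$ $(f\in\mathcal F,a\in K,k\ge0)$, and $\mathsf E_c:=\mathsf E\circ\mathsf S_c$. **Modules.** A differential Rota-Baxter module $(M,D,I)$ over $(\mathcal F,\partial,\int)$ is an $\mathcal F$-module $M$ with $K$-linear maps $D,I$ satisfying $D(f\phi)=(\partial f)\phi+f\,D\phi$, $(\int f)\cdot I\phi=I(f\,I\phi)+I((\int f)\phi)$ and $D\circ I=1_M$. It is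 an integro-differential module if $\mathsf E:=1_M-ID$ satisfies $\mathsf E(f\phi)=\mathsf e(f)\mathsf E(\phi)$; it is ordinary if $\ker D=K$. It is shifted, with respect to a group homomorphism $c\mapsto\mathsf S_c$ from $(K,+)$ to the group of $K$-linear automorphisms of $M$ satisfying $\mathsf S_c(f\phi)=S_c(f)\mathsf S_c(\phi)$, if $[\mathsf S_c,I]=\mathsf E_c I$ and $[\mathsf S_c,D]=0$ for all $c\in K$. *)

theory Defs
  imports
    "HOL-Algebra.Module"
    "HOL-Algebra.AbelCoset"
    "HOL-Algebra.Algebraic_Closure_Type"
    "HOL-Library.Poly_Mapping"
begin

section \<open>Heaviside operator\<close>

definition heaviside :: "'k::linordered_field \<Rightarrow> 'k" where
  "heaviside a = (if a \<le> 0 then 0 else 1)"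

definition heaviside_bar :: "'k::linordered_field \<Rightarrow> 'k" where
  "heaviside_bar a = 1 - heaviside a"


section \<open>Integro-differential algebras\<close>

text \<open>
  The algebra is the whole type \<open>'f\<close>; the field is embedded in it by
  \<open>c \<mapsto> c \<cdot> 1\<close> (\<open>const_of\<close>). All operators that take values in the field
  (such as the evaluations) are rendered as operators on \<open>'f\<close> with values in the
  image of this embedding.
\<close>

record ('k, 'f) intdiff_ops =
  scal  :: "'k \<Rightarrow> 'f \<Rightarrow> 'f"
  der   :: "'f \<Rightarrow> 'f"
  integ :: "'f \<Rightarrow> 'f"

record ('k, 'f) shifted_ops = "('k, 'f) intdiff_ops" +
  shft  :: "'k \<Rightarrow> 'f \<Rightarrow> 'f"

definition const_of :: "('k, 'f::comm_ring_1, 'z) intdiff_ops_scheme \<Rightarrow> 'k \<Rightarrow> 'f" where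
  "const_of F c = scal F c 1"

locale differential_algebra =
  vector_space "scal F" for F :: "('k::field, 'f::comm_ring_1, 'z) intdiff_ops_scheme" +
  assumes scal_mult: "scal F c (f * g) = scal F c f * g"
    and der_linear: "Vector_Spaces.linear (scal F) (scal F) (der F)"
    and der_mult: "der F (f * g) = der F f * g + f * der F g"

locale integro_differential_algebra = differential_algebra +
  assumes integ_linear: "Vector_Spaces.linear (scal F) (scal F) (integ F)"
    and der_integ: "der F (integ F f) = f"
    and integ_by_parts: "f * integ F g = integ F (f * g) + integ F (der F f * integ F g)"

locale ordinary_integro_differential_algebra = integro_differential_algebra +
  assumes kernel_der: "{f. der F f = 0} = range (const_of F)"

definition ev :: "('k, 'f::comm_ring_1, 'z) intdiff_ops_scheme \<Rightarrow> 'f \<Rightarrow> 'f" where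
  "ev F f = f - integ F (der F f)"

definition ev_at :: "('k, 'f::comm_ring_1, 'z) shifted_ops_scheme \<Rightarrow> 'k \<Rightarrow> 'f \<Rightarrow> 'f" where
  "ev_at F c f = ev F (shft F c f)"

definition integ_from :: "('k, 'f::comm_ring_1, 'z) shifted_ops_scheme \<Rightarrow> 'k \<Rightarrow> 'f \<Rightarrow> 'f" where
  "integ_from F c f = integ F f - ev_at F c (integ F f)"

definition integ_from_to ::
    "('k, 'f::comm_ring_1, 'z) shifted_ops_scheme \<Rightarrow> 'k \<Rightarrow> 'k \<Rightarrow> 'f \<Rightarrow> 'f" where
  "integ_from_to F c d f = ev_at F d (integ_from F c f)"

definition algebra_automorphism ::
    "('k::field, 'f::comm_ring_1, 'z) intdiff_ops_scheme \<Rightarrow> ('f \<Rightarrow> 'f) \<Rightarrow> bool" where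
  "algebra_automorphism F s \<longleftrightarrow>
     bij s \<and> Vector_Spaces.linear (scal F) (scal F) s \<and>
     s 1 = 1 \<and> (\<forall>f g. s (f * g) = s f * s g)"

locale ordinary_shifted_integro_differential_algebra =
  ordinary_integro_differential_algebra F
  for F :: "('k::field, 'f::comm_ring_1, 'z) shifted_ops_scheme" +
  assumes shft_automorphism: "algebra_automorphism F (shft F c)"
    and shft_add: "shft F (c + d) = shft F c \<circ> shft F d"
    and shft_integ: "shft F c (integ F f) - integ F (shft F c f) = ev_at F c (integ F f)"
    and shft_der: "shft F c (der F f) - der F (shft F c f) = 0"


section \<open>Integro-differential modules\<close>

definition linear_over_field ::
    "('k, 'f::comm_ring_1, 'z) intdiff_ops_scheme \<Rightarrow> ('f, 'm, 'y) module_scheme \<Rightarrow> ('m \<Rightarrow> 'm) \<Rightarrow> bool"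
  where
  "linear_over_field F M T \<longleftrightarrow>
     T \<in> carrier M \<rightarrow> carrier M \<and>
     (\<forall>x\<in>carrier M. \<forall>y\<in>carrier M. T (x \<oplus>\<^bsub>M\<^esub> y) = T x \<oplus>\<^bsub>M\<^esub> T y) \<and>
     (\<forall>c. \<forall>x\<in>carrier M. T (const_of F c \<odot>\<^bsub>M\<^esub> x) = const_of F c \<odot>\<^bsub>M\<^esub> T x)"

definition mod_ev :: "('f, 'm, 'y) module_scheme \<Rightarrow> ('m \<Rightarrow> 'm) \<Rightarrow> ('m \<Rightarrow> 'm) \<Rightarrow> 'm \<Rightarrow> 'm" where
  "mod_ev M D I x = x \<ominus>\<^bsub>M\<^esub> I (D x)"

definition mod_ev_at ::
    "('f, 'm, 'y) module_scheme \<Rightarrow> ('m \<Rightarrow> 'm) \<Rightarrow> ('m \<Rightarrow> 'm) \<Rightarrow> ('k \<Rightarrow> 'm \<Rightarrow> 'm) \<Rightarrow> 'k \<Rightarrow> 'm \<Rightarrow> 'm"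
  where
  "mod_ev_at M D I S c x = mod_ev M D I (S c x)"

definition mod_integ_from ::
    "('f, 'm, 'y) module_scheme \<Rightarrow> ('m \<Rightarrow> 'm) \<Rightarrow> ('m \<Rightarrow> 'm) \<Rightarrow> ('k \<Rightarrow> 'm \<Rightarrow> 'm) \<Rightarrow> 'k \<Rightarrow> 'm \<Rightarrow> 'm"
  where
  "mod_integ_from M D I S c x = I x \<ominus>\<^bsub>M\<^esub> mod_ev_at M D I S c (I x)"

locale differential_rota_baxter_module =
  integro_differential_algebra F + M: Module.module ring_of_type_algebra M
  for F :: "('k::field, 'f::comm_ring_1, 'z) intdiff_ops_scheme"
    and M :: "('f, 'm, 'y) module_scheme" (structure) +
  fixes D I :: "'m \<Rightarrow> 'm"
  assumes D_linear: "linear_over_field F M D"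
    and I_linear: "linear_over_field F M I"
    and D_smult: "x \<in> carrier M \<Longrightarrow> D (f \<odot> x) = der F f \<odot> x \<oplus>\<^bsub>M\<^esub> f \<odot> D x"
    and rota_baxter: "x \<in> carrier M \<Longrightarrow>
        integ F f \<odot> I x = I (f \<odot> I x) \<oplus>\<^bsub>M\<^esub> I (integ F f \<odot> x)"
    and D_I: "x \<in> carrier M \<Longrightarrow> D (I x) = x"

locale integro_differential_module = differential_rota_baxter_module +
  assumes ev_smult: "x \<in> carrier M \<Longrightarrow> mod_ev M D I (f \<odot> x) = ev F f \<odot> mod_ev M D I x"

text \<open>
  A module contains no copy of the field by itself, so \<open>ker D = K\<close> refers to the
  embedding \<open>c \<mapsto> c \<cdot> u\<close> given by a distinguished element \<open>u\<close> of the module.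
\<close>

locale ordinary_integro_differential_module = integro_differential_module +
  fixes u :: 'd
  assumes unit_closed: "u \<in> carrier M"
    and field_embedding: "inj (\<lambda>c. const_of F c \<odot> u)"
    and kernel_D: "{x \<in> carrier M. D x = \<zero>\<^bsub>M\<^esub>} = range (\<lambda>c. const_of F c \<odot> u)"

locale ordinary_shifted_integro_differential_module =
  ordinary_integro_differential_module F M D I u
  for F :: "('k::field, 'f::comm_ring_1, 'z) shifted_ops_scheme"
    and M :: "('f, 'm, 'y) module_scheme" (structure)
    and D I and u +
  fixes S :: "'k \<Rightarrow> 'm \<Rightarrow> 'm"
  assumes S_linear: "linear_over_field F M (S c)"
    and S_bij: "bij_betw (S c) (carrier M) (carrier M)"
    and S_add: "x \<in> carrier M \<Longrightarrow> S (c + d) x = S c (S d x)"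
    and S_smult: "x \<in> carrier M \<Longrightarrow> S c (f \<odot> x) = shft F c f \<odot> S c x"
    and S_I: "x \<in> carrier M \<Longrightarrow> S c (I x) \<ominus>\<^bsub>M\<^esub> I (S c x) = mod_ev_at M D I S c (I x)"
    and S_D: "x \<in> carrier M \<Longrightarrow> S c (D x) \<ominus>\<^bsub>M\<^esub> D (S c x) = \<zero>\<^bsub>M\<^esub>"


section \<open>Quotients of modules\<close>

definition differential_submodule_generated ::
    "('f::comm_ring_1, 'm, 'y) module_scheme \<Rightarrow> ('m \<Rightarrow> 'm) \<Rightarrow> 'm set \<Rightarrow> 'm set" where
  "differential_submodule_generated M d G =
     \<Inter>{N. submodule N ring_of_type_algebra M \<and> d ` N \<subseteq> N \<and> G \<subseteq> N}"

definition quotient_module :: "('f, 'm, 'y) module_scheme \<Rightarrow> 'm set \<Rightarrow> ('f, 'm set) module" where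
  "quotient_module M N =
     \<lparr> carrier = a_rcosets\<^bsub>M\<^esub> N, monoid.mult = undefined, one = undefined,
       zero = N, add = (<+>\<^bsub>M\<^esub>),
       Module.module.smult = (\<lambda>f C. \<Union>x\<in>C. N +>\<^bsub>M\<^esub> (f \<odot>\<^bsub>M\<^esub> x)) \<rparr>"

text \<open>
  For an additive \<open>T\<close> that maps \<open>N\<close> into \<open>N\<close>, this sends the coset of \<open>x\<close> to
  the coset of \<open>T x\<close>. If \<open>T\<close> does not respect the cosets, some value is a union
  of several cosets and thus lies outside the quotient module; hence closure on
  the carrier expresses that the induced map is well defined.
\<close>

definition induced_map :: "('f, 'm, 'y) module_scheme \<Rightarrow> 'm set \<Rightarrow> ('m \<Rightarrow> 'm) \<Rightarrow> 'm set \<Rightarrow> 'm set" where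
  "induced_map M N T C = (\<Union>x\<in>C. N +>\<^bsub>M\<^esub> T x)"


section \<open>The distribution module\<close>

text \<open>\<open>BH a k\<close> stands for the \<open>k\<close>-th derivative of the Heaviside function \<open>H\<^sub>a\<close>.\<close>

datatype 'k dist_basis = B1 | BH 'k nat

type_synonym ('k, 'f) pre_dist = "'k dist_basis \<Rightarrow>\<^sub>0 'f"

definition free_dist :: "('f::comm_ring_1, ('k, 'f) pre_dist) module" where
  "free_dist =
     \<lparr> carrier = UNIV, monoid.mult = undefined, one = undefined, zero = 0, add = (+),
       Module.module.smult = (\<lambda>f. Poly_Mapping.map ((*) f)) \<rparr>"

text \<open>The additive extension of a map prescribed on the products \<open>f \<cdot> b\<close>, \<open>b\<close> a basis element.\<close>

definition extend ::
    "('k dist_basis \<Rightarrow> 'f \<Rightarrow> ('k, 'f) pre_dist) \<Rightarrow> ('k, 'f::comm_ring_1) pre_dist \<Rightarrow> ('k, 'f) pre_dist"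
  where
  "extend T p = (\<Sum>b\<in>Poly_Mapping.keys p. T b (Poly_Mapping.lookup p b))"

primrec der_term ::
    "('k, 'f::comm_ring_1, 'z) shifted_ops_scheme \<Rightarrow> 'k dist_basis \<Rightarrow> 'f \<Rightarrow> ('k, 'f) pre_dist" where
  "der_term F B1 f = Poly_Mapping.single B1 (der F f)"
| "der_term F (BH a k) f =
     Poly_Mapping.single (BH a k) (der F f) + Poly_Mapping.single (BH a (Suc k)) f"

fun integ_heaviside_term ::
    "('k::linordered_field, 'f::comm_ring_1, 'z) shifted_ops_scheme \<Rightarrow> 'k \<Rightarrow> nat \<Rightarrow> 'f \<Rightarrow> ('k, 'f) pre_dist"
  where
  "integ_heaviside_term F a 0 f =
     Poly_Mapping.single (BH a 0) (integ_from F a f) +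
     Poly_Mapping.single B1 (scal F (heaviside_bar a) (integ_from_to F 0 a f))"
| "integ_heaviside_term F a (Suc 0) f =
     Poly_Mapping.single (BH a 0) (ev_at F a f) -
     Poly_Mapping.single B1 (scal F (heaviside_bar a) (ev_at F a f))"
| "integ_heaviside_term F a (Suc (Suc k)) f =
     Poly_Mapping.single (BH a (Suc k)) f - integ_heaviside_term F a (Suc k) (der F f)"

primrec integ_term ::
    "('k::linordered_field, 'f::comm_ring_1, 'z) shifted_ops_scheme \<Rightarrow> 'k dist_basis \<Rightarrow> 'f \<Rightarrow> ('k, 'f) pre_dist"
  where
  "integ_term F B1 f = Poly_Mapping.single B1 (integ F f)"
| "integ_term F (BH a k) f = integ_heaviside_term F a k f"

primrec shft_term ::
    "('k::linordered_field, 'f::comm_ring_1, 'z) shifted_ops_scheme \<Rightarrow> 'k \<Rightarrow> 'k dist_basis \<Rightarrow> 'f \<Rightarrow> ('k, 'f) pre_dist"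
  where
  "shft_term F c B1 f = Poly_Mapping.single B1 (shft F c f)"
| "shft_term F c (BH a k) f = Poly_Mapping.single (BH (a - c) k) (shft F c f)"

definition dist_relations :: "('k, 'f::comm_ring_1, 'z) shifted_ops_scheme \<Rightarrow> ('k, 'f) pre_dist set" where
  "dist_relations F =
     differential_submodule_generated free_dist (extend (der_term F))
       {Poly_Mapping.single (BH a (Suc 0)) f - Poly_Mapping.single (BH a (Suc 0)) (ev_at F a f) | a f. True}"

definition dist_module ::
    "('k, 'f::comm_ring_1, 'z) shifted_ops_scheme \<Rightarrow> ('f, ('k, 'f) pre_dist set) module" where
  "dist_module F = quotient_module free_dist (dist_relations F)"

definition dist_class ::
    "('k, 'f::comm_ring_1, 'z) shifted_ops_scheme \<Rightarrow> ('k, 'f) pre_dist \<Rightarrow> ('k, 'f) pre_dist set" where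
  "dist_class F p = dist_relations F +>\<^bsub>free_dist\<^esub> p"

definition dist_D ::
    "('k, 'f::comm_ring_1, 'z) shifted_ops_scheme \<Rightarrow> ('k, 'f) pre_dist set \<Rightarrow> ('k, 'f) pre_dist set" where
  "dist_D F = induced_map free_dist (dist_relations F) (extend (der_term F))"

definition dist_I ::
    "('k::linordered_field, 'f::comm_ring_1, 'z) shifted_ops_scheme \<Rightarrow> ('k, 'f) pre_dist set \<Rightarrow> ('k, 'f) pre_dist set"
  where
  "dist_I F = induced_map free_dist (dist_relations F) (extend (integ_term F))"

definition dist_S ::
    "('k::linordered_field, 'f::comm_ring_1, 'z) shifted_ops_scheme \<Rightarrow> 'k \<Rightarrow>
     ('k, 'f) pre_dist set \<Rightarrow> ('k, 'f) pre_dist set"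
  where
  "dist_S F c = induced_map free_dist (dist_relations F) (extend (shft_term F c))"

definition dist_I_from ::
    "('k::linordered_field, 'f::comm_ring_1, 'z) shifted_ops_scheme \<Rightarrow> 'k \<Rightarrow>
     ('k, 'f) pre_dist set \<Rightarrow> ('k, 'f) pre_dist set"
  where
  "dist_I_from F = mod_integ_from (dist_module F) (dist_D F) (dist_I F) (dist_S F)"

definition dist_one :: "('k, 'f::comm_ring_1, 'z) shifted_ops_scheme \<Rightarrow> ('k, 'f) pre_dist set" where
  "dist_one F = dist_class F (Poly_Mapping.single B1 1)"

definition dist_const :: "('k, 'f::comm_ring_1, 'z) shifted_ops_scheme \<Rightarrow> 'k \<Rightarrow> ('k, 'f) pre_dist set" where
  "dist_const F c = const_of F c \<odot>\<^bsub>dist_module F\<^esub> dist_one F"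

definition dist_H :: "('k, 'f::comm_ring_1, 'z) shifted_ops_scheme \<Rightarrow> 'k \<Rightarrow> ('k, 'f) pre_dist set" where
  "dist_H F a = dist_class F (Poly_Mapping.single (BH a 0) 1)"

definition dist_H_bar :: "('k, 'f::comm_ring_1, 'z) shifted_ops_scheme \<Rightarrow> 'k \<Rightarrow> ('k, 'f) pre_dist set" where
  "dist_H_bar F a = dist_one F \<ominus>\<^bsub>dist_module F\<^esub> dist_H F a"

definition dist_delta ::
    "('k, 'f::comm_ring_1, 'z) shifted_ops_scheme \<Rightarrow> 'k \<Rightarrow> nat \<Rightarrow> ('k, 'f) pre_dist set" where
  "dist_delta F a k = dist_class F (Poly_Mapping.single (BH a (Suc k)) 1)"

end

theory Submission
  imports Defs
begin

text \<open>
  All operators of the distribution module are induced by additive operators on the free module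
  with basis \<open>1, H\<^sub>a\<^sup>(\<^sup>k\<^sup>)\<close>, written \<open>free_D\<close>, \<open>free_I\<close> and \<open>free_S c\<close> below, so every claim
  becomes a congruence modulo the submodule \<open>Z\<close> of relations. Three facts carry the proof.

  First, \<open>Z\<close> can be described explicitly (\<open>Z_eq_annihilator\<close>). As in the analytic theory, pair
  \<open>f \<delta>\<^sub>a\<^sup>(\<^sup>k\<^sup>)\<close> with a test function \<open>g\<close> to get \<open>(-1)\<^sup>k \<e>\<^sub>a((f g)\<^sup>(\<^sup>k\<^sup>))\<close>. An element belongs to \<open>Z\<close>
  iff its coefficients at \<open>1\<close> and at all \<open>H\<^sub>a\<close> vanish and all its pairings at all points vanish:
  the relations are killed by every pairing because \<open>\<e>\<^sub>a\<close> is multiplicative; conversely, modulo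
  \<open>Z\<close> the coefficients of the \<open>\<delta>\<^sub>a\<^sup>(\<^sup>k\<^sup>)\<close> can be made constant, and constant coefficients are read
  off by pairing with the divided powers of \<open>x - a\<close>, that is, the shifted iterated integrals of 1.

  Second, differentiation is adjoint to differentiation of test functions up to sign and a boundary term:
  the pairing of \<open>D p\<close> with \<open>g\<close> is \<open>\<e>\<^sub>a(h g)\<close> minus the pairing of \<open>p\<close> with \<open>g'\<close>, where \<open>h\<close> is the
  coefficient of \<open>p\<close> at \<open>H\<^sub>a\<close> (\<open>pairing_free_D\<close>). So if \<open>D p \<in> Z\<close>, then \<open>g = 1\<close> shows that the
  constant \<open>h\<close> vanishes, and, as every test function is a derivative, all pairings of \<open>p\<close> vanish.
  Hence \<open>p\<close> is a constant modulo \<open>Z\<close> (\<open>kernel_free_D_modulo_Z\<close>), which is ordinariness.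

  Third, \<open>1 - I D\<close> takes only multiples of the basis element 1 as values already on the free
  module (\<open>monomial_free_E_eq\<close>), namely \<open>f \<mapsto> \<e>(f)\<close>, \<open>f H\<^sub>a \<mapsto> (1 - H(a)) \<e>(f)\<close> and
  \<open>f \<delta>\<^sub>a\<^sup>(\<^sup>k\<^sup>) \<mapsto> 0\<close>. Multiplicativity of the evaluation of the module is thus inherited from \<open>\<e>\<close>.
  The functional \<open>free_E\<close> with these values vanishes on \<open>Z\<close> and on the image of \<open>I\<close>. Together
  with \<open>D I p - p \<in> Z\<close> and the second fact this gives that \<open>I\<close> maps \<open>Z\<close> to itself: for \<open>p \<in> Z\<close>
  the element \<open>I p\<close> is a constant modulo \<open>Z\<close>, and that constant is \<open>free_E (I p) = 0\<close>.

  The Rota-Baxter identity and the law for the commutator of shift and integral then follow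
  formally from \<open>D I = 1\<close>, the Leibniz rule and the third fact. The recursion for \<open>I\<^sub>b\<close> is the
  one for \<open>I\<close>, because \<open>free_E\<close> kills \<open>f \<delta>\<^sub>a\<^sup>(\<^sup>k\<^sup>)\<close> and its shifts; its base case compares the values of
  the shifted \<open>H\<^sub>a\<close> at 0.
\<close>


section \<open>Additive maps on finitely supported functions\<close>

text \<open>
  The construction underlying \<open>extend\<close>, with values in any commutative monoid: the functionals
  on the free module are built in the same way as its operators.
\<close>

definition sum_terms ::
    "('b \<Rightarrow> 'f::zero \<Rightarrow> 'c::comm_monoid_add) \<Rightarrow> ('b \<Rightarrow>\<^sub>0 'f) \<Rightarrow> 'c" where
  "sum_terms T p = (\<Sum>b\<in>Poly_Mapping.keys p. T b (Poly_Mapping.lookup p b))"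

lemma extend_eq_sum_terms: "extend T = sum_terms T"
  by (simp add: fun_eq_iff extend_def sum_terms_def)

lemma additive_sum_terms:
  fixes T :: "'b \<Rightarrow> 'f::ab_group_add \<Rightarrow> 'c::ab_group_add"
  assumes "\<And>b. additive (T b)"
  shows "additive (sum_terms T)"
proof
  fix p q
  show "sum_terms T (p + q) = sum_terms T p + sum_terms T q"
    unfolding sum_terms_def
    by (rule setsum_keys_plus_distrib) (simp_all add: additive.zero[OF assms] additive.add[OF assms])
qed

lemma sum_terms_single:
  fixes T :: "'b \<Rightarrow> 'f::ab_group_add \<Rightarrow> 'c::ab_group_add"
  assumes "additive (T b)"
  shows "sum_terms T (Poly_Mapping.single b f) = T b f"
  by (simp add: sum_terms_def additive.zero[OF assms])

lemma poly_mapping_eq_sum_single: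
  fixes p :: "'b \<Rightarrow>\<^sub>0 'f::comm_monoid_add"
  shows "p = (\<Sum>b\<in>Poly_Mapping.keys p. Poly_Mapping.single b (Poly_Mapping.lookup p b))"
  by (rule poly_mapping_eqI)
    (auto simp: lookup_sum lookup_single when_def sum.delta' in_keys_iff)

lemma poly_mapping_single_induct [case_names single add]:
  fixes P :: "('b \<Rightarrow>\<^sub>0 'f::comm_monoid_add) \<Rightarrow> bool"
  assumes "\<And>b f. P (Poly_Mapping.single b f)" and "\<And>p q. P p \<Longrightarrow> P q \<Longrightarrow> P (p + q)"
  shows "P p"
proof -
  have "P (\<Sum>b\<in>B. Poly_Mapping.single b (Poly_Mapping.lookup p b))" if "finite B" for B
    using that
  proof induction
    case empty
    show ?case using assms(1)[of undefined 0] by simp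
  qed (simp add: assms)
  then show ?thesis
    by (subst poly_mapping_eq_sum_single) simp
qed


section \<open>Evaluations of an ordinary shifted integro-differential algebra\<close>

locale shifted_algebra = ordinary_shifted_integro_differential_algebra F
  for F :: "('k::linordered_field, 'f::comm_ring_1, 'z) shifted_ops_scheme"
begin

lemma additive_der: "additive (der F)"
proof -
  interpret L: Vector_Spaces.linear "scal F" "scal F" "der F" by (rule der_linear)
  show ?thesis by unfold_locales (rule L.add)
qed

lemma additive_integ: "additive (integ F)"
proof -
  interpret L: Vector_Spaces.linear "scal F" "scal F" "integ F" by (rule integ_linear)
  show ?thesis by unfold_locales (rule L.add)
qed

lemma additive_shft: "additive (shft F c)"
proof -
  interpret L: Vector_Spaces.linear "scal F" "scal F" "shft F c"
    using shft_automorphism by (simp add: algebra_automorphism_def)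
  show ?thesis by unfold_locales (rule L.add)
qed

lemma shft_scal: "shft F c (scal F k f) = scal F k (shft F c f)"
proof -
  interpret L: Vector_Spaces.linear "scal F" "scal F" "shft F c"
    using shft_automorphism by (simp add: algebra_automorphism_def)
  show ?thesis by (rule L.scale)
qed

lemma additive_ev: "additive (ev F)"
  by unfold_locales (simp add: ev_def additive.add[OF additive_der] additive.add[OF additive_integ])

lemma additive_ev_at: "additive (ev_at F c)"
  by unfold_locales (simp add: ev_at_def additive.add[OF additive_shft] additive.add[OF additive_ev])

lemmas der_simps [simp] = additive.add[OF additive_der] additive.diff[OF additive_der]
  additive.minus[OF additive_der] additive.zero[OF additive_der]
lemmas integ_simps [simp] = additive.add[OF additive_integ] additive.diff[OF additive_integ]
  additive.minus[OF additive_integ] additive.zero[OF additive_integ]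
lemmas shft_simps [simp] = additive.add[OF additive_shft] additive.diff[OF additive_shft]
  additive.minus[OF additive_shft] additive.zero[OF additive_shft]
lemmas ev_simps [simp] = additive.add[OF additive_ev] additive.diff[OF additive_ev]
  additive.minus[OF additive_ev] additive.zero[OF additive_ev]
lemmas ev_at_simps [simp] = additive.add[OF additive_ev_at] additive.diff[OF additive_ev_at]
  additive.minus[OF additive_ev_at] additive.zero[OF additive_ev_at]

lemma scal_eq_const_mult: "scal F c f = const_of F c * f"
  by (metis const_of_def mult_1_left scal_mult)

lemma der_const_of [simp]: "der F (const_of F c) = 0"
  using kernel_der by auto

lemma constE:
  assumes "der F h = 0"
  obtains c where "h = const_of F c"
  using assms kernel_der by auto

lemma const_of_one [simp]: "const_of F 1 = 1"
  by (simp add: const_of_def)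

lemma const_of_zero [simp]: "const_of F 0 = 0"
  by (simp add: const_of_def)

lemma const_of_diff: "const_of F (c - d) = const_of F c - const_of F d"
  by (simp add: const_of_def scale_left_diff_distrib)

lemma const_of_eq_0_iff [simp]: "const_of F c = 0 \<longleftrightarrow> c = 0"
  by (simp add: const_of_def)

lemma der_one [simp]: "der F 1 = 0"
  using der_const_of[of 1] by simp

lemma integ_const_mult: "der F h = 0 \<Longrightarrow> integ F (h * f) = h * integ F f"
  using integ_by_parts[of h f] by simp

lemma der_ev [simp]: "der F (ev F f) = 0"
  by (simp add: ev_def der_integ)

lemma ev_const: "der F h = 0 \<Longrightarrow> ev F h = h"
  by (simp add: ev_def)

lemma ev_integ [simp]: "ev F (integ F f) = 0"
  by (simp add: ev_def der_integ)

lemma eq_ev_plus_integ: "f = ev F f + integ F (der F f)"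
  by (simp add: ev_def)

text \<open>
  Integration by parts says precisely that the kernel of the evaluation, which is the image of
  the integral, is an ideal; multiplicativity of the evaluation follows.
\<close>

lemma ev_mult_integ: "ev F (f * integ F g) = 0"
proof -
  have "ev F (f * integ F g) = f * integ F g - integ F (der F f * integ F g + f * g)"
    by (simp add: ev_def der_mult der_integ)
  also have "\<dots> = 0"
    using integ_by_parts[of f g] by simp
  finally show ?thesis .
qed

lemma ev_mult: "ev F (f * g) = ev F f * ev F g"
proof -
  have "ev F (f * g) = ev F (f * ev F g) + ev F (f * integ F (der F g))"
    by (subst (1) eq_ev_plus_integ[of g]) 
      (simp add: distrib_left del: ev_simps flip: additive.add[OF additive_ev])
  also have "\<dots> = ev F (f * ev F g)"
    by (simp add: ev_mult_integ)
  also have "\<dots> = ev F (ev F f * ev F g) + ev F (ev F g * integ F (der F f))"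
    by (subst (1) eq_ev_plus_integ[of f])
      (simp add: algebra_simps del: ev_simps flip: additive.add[OF additive_ev])
  also have "\<dots> = ev F f * ev F g"
    by (simp add: ev_mult_integ ev_const der_mult)
  finally show ?thesis .
qed

lemma shft_mult: "shft F c (f * g) = shft F c f * shft F c g"
  and shft_one [simp]: "shft F c 1 = 1"
  and bij_shft: "bij (shft F c)"
  using shft_automorphism[of c] by (simp_all add: algebra_automorphism_def)

lemma shft_shft: "shft F c (shft F d f) = shft F (c + d) f"
  by (simp add: shft_add)

lemma shft_0 [simp]: "shft F 0 f = f"
  using shft_shft[of 0 0 f] bij_shft[of 0] by (simp add: bij_def inj_eq)

lemma shft_const_of [simp]: "shft F c (const_of F k) = const_of F k"
  by (simp add: const_of_def shft_scal)

lemma shft_const: "der F h = 0 \<Longrightarrow> shft F c h = h"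
  by (erule constE) simp

lemma der_shft: "der F (shft F c f) = shft F c (der F f)"
  using shft_der[of c f] by simp

lemma der_ev_at [simp]: "der F (ev_at F a f) = 0"
  by (simp add: ev_at_def)

lemma ev_at_const: "der F h = 0 \<Longrightarrow> ev_at F a h = h"
  by (simp add: ev_at_def shft_const ev_const)

lemma ev_at_mult: "ev_at F a (f * g) = ev_at F a f * ev_at F a g"
  by (simp add: ev_at_def shft_mult ev_mult)

lemma ev_at_shft: "ev_at F a (shft F c f) = ev_at F (a + c) f"
  by (simp add: ev_at_def shft_shft)

lemma ev_at_0: "ev_at F 0 f = ev F f"
  by (simp add: ev_at_def)

lemma integ_from_eq: "integ_from F a f = integ F f - ev_at F a (integ F f)"
  by (simp add: integ_from_def)

lemma integ_from_to_eq: "integ_from_to F 0 a f = ev_at F a (integ F f)"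
  by (simp add: integ_from_to_def integ_from_def ev_at_0)


section \<open>The free module and its operators\<close>

abbreviation free_smult :: "'f \<Rightarrow> ('k, 'f) pre_dist \<Rightarrow> ('k, 'f) pre_dist" (infixr "\<cdot>" 75) where
  "f \<cdot> p \<equiv> Poly_Mapping.map ((*) f) p"

abbreviation monomial :: "'f \<Rightarrow> 'k dist_basis \<Rightarrow> ('k, 'f) pre_dist" (infix "\<diamondop>" 76) where
  "f \<diamondop> b \<equiv> Poly_Mapping.single b f"

abbreviation "free_D \<equiv> extend (der_term F)"
abbreviation "free_I \<equiv> extend (integ_term F)"
abbreviation "free_S c \<equiv> extend (shft_term F c)"

lemma monomial_add: "(f + g) \<diamondop> b = f \<diamondop> b + g \<diamondop> b"
  by (rule single_add)

lemma monomial_minus: "(- f) \<diamondop> b = - (f \<diamondop> b)"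
  by (rule single_uminus)

lemma monomial_diff: "(f - g) \<diamondop> b = f \<diamondop> b - g \<diamondop> b"
  by (rule single_diff)

lemma smult_monomial [simp]: "f \<cdot> (g \<diamondop> b) = (f * g) \<diamondop> b"
  by simp

lemma lookup_smult [simp]: "Poly_Mapping.lookup (f \<cdot> p) b = f * Poly_Mapping.lookup p b"
  by (simp add: map.rep_eq when_def)

lemma additive_smult: "additive ((\<cdot>) f)"
  by unfold_locales (rule poly_mapping_eqI, simp add: lookup_add distrib_left)

lemmas smult_simps [simp] = additive.add[OF additive_smult] additive.diff[OF additive_smult]
  additive.minus[OF additive_smult] additive.zero[OF additive_smult]

lemma smult_add_left: "(f + g) \<cdot> p = f \<cdot> p + g \<cdot> p"
  by (rule poly_mapping_eqI) (simp add: lookup_add distrib_right)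

lemma smult_zero_left [simp]: "0 \<cdot> p = 0"
  by (rule poly_mapping_eqI) simp

lemma smult_smult: "f \<cdot> g \<cdot> p = (f * g) \<cdot> p"
  by (rule poly_mapping_eqI) (simp add: mult.assoc)

lemma smult_one [simp]: "1 \<cdot> p = p"
  by (rule poly_mapping_eqI) simp

lemma smult_minus_one [simp]: "(- 1) \<cdot> p = - p"
  by (rule poly_mapping_eqI) simp

lemma additive_der_term: "additive (der_term F b)"
  by (cases b; unfold_locales) (simp_all add: monomial_add)

lemma additive_shft_term: "additive (shft_term F c b)"
  by (cases b; unfold_locales) (simp_all add: monomial_add)

lemma integ_from_const_mult: "der F h = 0 \<Longrightarrow> integ_from F a (h * f) = h * integ_from F a f"
  by (simp add: integ_from_def integ_const_mult ev_at_mult ev_at_const right_diff_distrib)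

lemma integ_from_to_const_mult:
  "der F h = 0 \<Longrightarrow> integ_from_to F 0 a (h * f) = h * integ_from_to F 0 a f"
  by (simp add: integ_from_to_eq integ_const_mult ev_at_mult ev_at_const)

lemma integ_heaviside_term_add:
  "integ_heaviside_term F a k (f + g) = integ_heaviside_term F a k f + integ_heaviside_term F a k g"
proof (induction k arbitrary: f g)
  case 0
  show ?case
    by (simp add: integ_from_eq integ_from_to_eq scal_eq_const_mult monomial_add monomial_diff
        algebra_simps)
next
  case (Suc k)
  then show ?case
    by (cases k) (simp_all add: scal_eq_const_mult monomial_add algebra_simps)
qed

lemma additive_integ_term: "additive (integ_term F b)"
  by (cases b; unfold_locales) (simp_all add: integ_heaviside_term_add monomial_add)

lemma additive_free_D: "additive free_D"
  unfolding extend_eq_sum_terms by (intro additive_sum_terms additive_der_term)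

lemma additive_free_I: "additive free_I"
  unfolding extend_eq_sum_terms by (intro additive_sum_terms additive_integ_term)

lemma additive_free_S: "additive (free_S c)"
  unfolding extend_eq_sum_terms by (intro additive_sum_terms additive_shft_term)

lemmas free_D_simps [simp] = additive.add[OF additive_free_D] additive.diff[OF additive_free_D]
  additive.minus[OF additive_free_D] additive.zero[OF additive_free_D]
lemmas free_I_simps [simp] = additive.add[OF additive_free_I] additive.diff[OF additive_free_I]
  additive.minus[OF additive_free_I] additive.zero[OF additive_free_I]
lemmas free_S_simps [simp] = additive.add[OF additive_free_S] additive.diff[OF additive_free_S]
  additive.minus[OF additive_free_S] additive.zero[OF additive_free_S]

lemma free_D_monomial [simp]: "free_D (f \<diamondop> b) = der_term F b f"
  unfolding extend_eq_sum_terms by (rule sum_terms_single, rule additive_der_term)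

lemma free_I_monomial [simp]: "free_I (f \<diamondop> b) = integ_term F b f"
  unfolding extend_eq_sum_terms by (rule sum_terms_single, rule additive_integ_term)

lemma free_S_monomial [simp]: "free_S c (f \<diamondop> b) = shft_term F c b f"
  unfolding extend_eq_sum_terms by (rule sum_terms_single, rule additive_shft_term)

lemma free_D_smult: "free_D (f \<cdot> p) = der F f \<cdot> p + f \<cdot> free_D p"
proof (induction p rule: poly_mapping_single_induct)
  case (single b g)
  show ?case by (cases b) (simp_all add: der_mult monomial_add)
qed (simp_all add: distrib_left add_ac)

lemma integ_heaviside_term_const_mult:
  assumes "der F h = 0"
  shows "integ_heaviside_term F a k (h * f) = h \<cdot> integ_heaviside_term F a k f"
proof (induction k arbitrary: f)
  case 0
  show ?case
    using assms
    by (simp add: integ_from_const_mult integ_from_to_const_mult scal_eq_const_mult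
        mult.left_commute)
next
  case (Suc k)
  then show ?case
    using assms
    by (cases k)
      (simp_all add: scal_eq_const_mult ev_at_mult ev_at_const der_mult mult.left_commute)
qed

lemma free_I_const_smult:
  assumes "der F h = 0"
  shows "free_I (h \<cdot> p) = h \<cdot> free_I p"
proof (induction p rule: poly_mapping_single_induct)
  case (single b g)
  show ?case
    using assms by (cases b) (simp_all add: integ_const_mult integ_heaviside_term_const_mult)
qed simp

lemma free_S_smult: "free_S c (f \<cdot> p) = shft F c f \<cdot> free_S c p"
proof (induction p rule: poly_mapping_single_induct)
  case (single b g)
  show ?case by (cases b) (simp_all add: shft_mult)
qed simp

lemma free_S_free_D: "free_S c (free_D p) = free_D (free_S c p)"
proof (induction p rule: poly_mapping_single_induct)
  case (single b g)
  show ?case by (cases b) (simp_all add: der_shft)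
qed simp

lemma free_S_free_S: "free_S c (free_S d p) = free_S (c + d) p"
proof (induction p rule: poly_mapping_single_induct)
  case (single b g)
  show ?case by (cases b) (simp_all add: shft_shft algebra_simps)
qed simp

lemma free_S_0 [simp]: "free_S 0 p = p"
proof (induction p rule: poly_mapping_single_induct)
  case (single b g)
  show ?case by (cases b) simp_all
qed simp


section \<open>The evaluation on the free module\<close>

text \<open>
  The values of the evaluation \<open>1 - I D\<close> on the free module, as coefficients at the basis
  element 1.
\<close>

primrec ev_term :: "'k dist_basis \<Rightarrow> 'f \<Rightarrow> 'f" where
  "ev_term B1 f = ev F f"
| "ev_term (BH a k) f = (if k = 0 then const_of F (heaviside_bar a) * ev F f else 0)"

abbreviation "free_E \<equiv> sum_terms ev_term"

lemma additive_ev_term: "additive (ev_term b)"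
  by (cases b; unfold_locales) (simp_all add: distrib_left)

lemma additive_free_E: "additive free_E"
  by (intro additive_sum_terms additive_ev_term)

lemmas free_E_simps [simp] = additive.add[OF additive_free_E] additive.diff[OF additive_free_E]
  additive.minus[OF additive_free_E] additive.zero[OF additive_free_E]

lemma free_E_monomial [simp]: "free_E (f \<diamondop> b) = ev_term b f"
  by (rule sum_terms_single, rule additive_ev_term)

lemma free_E_smult: "free_E (f \<cdot> p) = ev F f * free_E p"
proof (induction p rule: poly_mapping_single_induct)
  case (single b g)
  show ?case by (cases b) (simp_all add: ev_mult ac_simps)
qed (simp_all add: distrib_left add_ac)

text \<open>
  On \<open>f H\<^sub>a\<close> this holds because the value of \<open>\<integral>\<^sub>a f\<close> at 0 is the negative of \<open>\<integral>\<^sub>0\<^sup>a f\<close>; on \<open>f \<delta>\<^sub>a\<close> the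
  value of \<open>\<e>\<^sub>a(f) H\<^sub>a\<close> at 0 is the constant that \<open>I\<close> subtracts from it.
\<close>

lemma free_E_free_I [simp]: "free_E (free_I p) = 0"
proof (induction p rule: poly_mapping_single_induct)
  case (single b g)
  show ?case
  proof (cases b)
    case B1
    then show ?thesis by simp
  next
    case (BH a k)
    have "free_E (integ_heaviside_term F a k g) = 0"
    proof (induction k arbitrary: g)
      case 0
      show ?case
        by (simp add: integ_from_eq integ_from_to_eq scal_eq_const_mult ev_mult ev_const algebra_simps)
    next
      case (Suc k)
      then show ?case
        by (cases k) (simp_all add: scal_eq_const_mult ev_mult ev_const)
    qed
    then show ?thesis by (simp add: BH)
  qed
qed simp

text \<open>
  The operator \<open>1 - I D\<close> annihilates \<open>f \<delta>\<^sub>a\<^sup>(\<^sup>k\<^sup>)\<close> because the recursion defining \<open>I\<close> is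
  integration by parts, that is, \<open>I(f' \<delta>\<^sub>a\<^sup>(\<^sup>k\<^sup>) + f \<delta>\<^sub>a\<^sup>(\<^sup>k\<^sup>+\<^sup>1\<^sup>)) = f \<delta>\<^sub>a\<^sup>(\<^sup>k\<^sup>)\<close>.
  On \<open>f H\<^sub>a\<close> the terms at \<open>H\<^sub>a\<close> cancel by \<open>\<integral>\<^sub>a f' = f - \<e>\<^sub>a(f)\<close>. Hence the identity is exact, not only
  a congruence modulo \<open>Z\<close>.
\<close>

lemma monomial_free_E_eq: "free_E p \<diamondop> B1 = p - free_I (free_D p)"
proof (induction p rule: poly_mapping_single_induct)
  case (single b g)
  show ?case
  proof (cases b)
    case B1
    then show ?thesis by (simp add: ev_def monomial_diff)
  next
    case (BH a k)
    have *: "integ F (der F g) = g - ev F g"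
      by (simp add: ev_def)
    show ?thesis
      by (cases k)
        (simp_all add: BH * integ_from_eq integ_from_to_eq scal_eq_const_mult monomial_diff
          ev_at_const algebra_simps)
  qed
qed (simp add: monomial_add)


section \<open>The submodule of relations\<close>

abbreviation "Z \<equiv> dist_relations F"

lemma free_dist_sel [simp]:
  "carrier (free_dist :: ('f, ('k, 'f) pre_dist) module) = UNIV"
  "zero (free_dist :: ('f, ('k, 'f) pre_dist) module) = 0"
  "add (free_dist :: ('f, ('k, 'f) pre_dist) module) = (+)"
  "Module.module.smult (free_dist :: ('f, ('k, 'f) pre_dist) module) = (\<lambda>f p. f \<cdot> p)"
  by (simp_all add: free_dist_def)

lemma module_free_dist:
  "Module.module ring_of_type_algebra (free_dist :: ('f, ('k, 'f) pre_dist) module)"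
proof (rule moduleI)
  show "cring (ring_of_type_algebra :: 'f ring)" by (rule cring_from_type_algebra)
  show "abelian_group (free_dist :: ('f, ('k, 'f) pre_dist) module)"
  proof (rule abelian_groupI)
    fix p :: "('k, 'f) pre_dist"
    have "- p + p = 0" by simp
    then show "\<exists>q\<in>carrier (free_dist :: ('f, ('k, 'f) pre_dist) module).
        q \<oplus>\<^bsub>free_dist\<^esub> p = \<zero>\<^bsub>free_dist\<^esub>"
      by (metis free_dist_sel(1-3) UNIV_I)
  qed (simp_all add: add_ac)
qed (simp_all add: ring_of_type_algebra_def smult_add_left smult_smult)

lemma a_inv_free_dist [simp]:
  "a_inv (free_dist :: ('f, ('k, 'f) pre_dist) module) p = - p"
proof -
  interpret Module.module ring_of_type_algebra "free_dist :: ('f, ('k, 'f) pre_dist) module"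
    by (rule module_free_dist)
  show ?thesis by (rule minus_equality) simp_all
qed

lemma submodule_free_dist_iff:
  "submodule N ring_of_type_algebra (free_dist :: ('f, ('k, 'f) pre_dist) module) \<longleftrightarrow>
     0 \<in> N \<and> (\<forall>p\<in>N. \<forall>q\<in>N. p + q \<in> N) \<and> (\<forall>f. \<forall>p\<in>N. f \<cdot> p \<in> N)"
proof -
  interpret Module.module ring_of_type_algebra "free_dist :: ('f, ('k, 'f) pre_dist) module"
    by (rule module_free_dist)
  let ?submodule = "submodule N ring_of_type_algebra (free_dist :: ('f, ('k, 'f) pre_dist) module)"
  show ?thesis
  proof
    assume N: ?submodule
    have "0 \<in> N"
      using subgroup.one_closed[OF submodule.axioms(1)[OF N]] by simp
    then show "0 \<in> N \<and> (\<forall>p\<in>N. \<forall>q\<in>N. p + q \<in> N) \<and> (\<forall>f. \<forall>p\<in>N. f \<cdot> p \<in> N)"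
      using submoduleE(4,5)[OF N] by (simp add: ring_of_type_algebra_def)
  next
    assume N: "0 \<in> N \<and> (\<forall>p\<in>N. \<forall>q\<in>N. p + q \<in> N) \<and> (\<forall>f. \<forall>p\<in>N. f \<cdot> p \<in> N)"
    then have "- p \<in> N" if "p \<in> N" for p
      using that smult_minus_one by metis
    with N show ?submodule
      by (intro submoduleI) simp_all
  qed
qed

text \<open>
  The induction principle for relations. Since the shifts satisfy its closure conditions, it gives
  at once that they preserve \<open>Z\<close>. It does not apply to \<open>free_I\<close>, which is not \<open>\<F>\<close>-linear.
\<close>

lemma relations_least:
  assumes "0 \<in> N" and "\<And>p q. p \<in> N \<Longrightarrow> q \<in> N \<Longrightarrow> p + q \<in> N" and "\<And>f p. p \<in> N \<Longrightarrow> f \<cdot> p \<in> N"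
    and "\<And>p. p \<in> N \<Longrightarrow> free_D p \<in> N"
    and "\<And>a f. f \<diamondop> BH a (Suc 0) - ev_at F a f \<diamondop> BH a (Suc 0) \<in> N"
  shows "Z \<subseteq> N"
proof -
  have "submodule N ring_of_type_algebra (free_dist :: ('f, ('k, 'f) pre_dist) module)"
    using assms(1-3) by (simp add: submodule_free_dist_iff)
  then show ?thesis
    unfolding dist_relations_def differential_submodule_generated_def
    using assms(4,5) by blast
qed

lemma submodule_relations:
  "submodule Z ring_of_type_algebra (free_dist :: ('f, ('k, 'f) pre_dist) module)"
  unfolding dist_relations_def differential_submodule_generated_def
  by (auto simp: submodule_free_dist_iff)

lemma zero_in_Z [simp]: "0 \<in> Z"
  and add_in_Z: "p \<in> Z \<Longrightarrow> q \<in> Z \<Longrightarrow> p + q \<in> Z"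
  and smult_in_Z: "p \<in> Z \<Longrightarrow> f \<cdot> p \<in> Z"
  using submodule_relations by (simp_all add: submodule_free_dist_iff)

lemma minus_in_Z: "p \<in> Z \<Longrightarrow> - p \<in> Z"
  using smult_in_Z[of p "- 1"] by simp

lemma diff_in_Z: "p \<in> Z \<Longrightarrow> q \<in> Z \<Longrightarrow> p - q \<in> Z"
  using add_in_Z[of p "- q"] minus_in_Z by simp

lemma free_D_in_Z: "p \<in> Z \<Longrightarrow> free_D p \<in> Z"
  unfolding dist_relations_def differential_submodule_generated_def by blast

lemma delta_in_Z: "f \<diamondop> BH a (Suc 0) - ev_at F a f \<diamondop> BH a (Suc 0) \<in> Z"
  unfolding dist_relations_def differential_submodule_generated_def by blast

lemma free_S_in_Z: "p \<in> Z \<Longrightarrow> free_S c p \<in> Z"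
proof -
  have "Z \<subseteq> {p. free_S c p \<in> Z}"
  proof (rule relations_least; (unfold mem_Collect_eq)?)
    fix a f
    show "free_S c (f \<diamondop> BH a (Suc 0) - ev_at F a f \<diamondop> BH a (Suc 0)) \<in> Z"
      using delta_in_Z[of "a - c" "shft F c f"] by (simp add: ev_at_shft shft_const)
  qed (simp_all add: add_in_Z smult_in_Z free_D_in_Z free_S_smult free_S_free_D)
  then show "p \<in> Z \<Longrightarrow> free_S c p \<in> Z" by blast
qed


section \<open>Pairing with test functions\<close>

text \<open>
  The pairing at the point \<open>a\<close> of the distributional part with the test function \<open>g\<close>. As \<open>\<delta>\<^sub>a\<^sup>(\<^sup>j\<^sup>)\<close> is
  the basis element \<open>BH a (j + 1)\<close>, the exponent is \<open>k - 1\<close>; the summands of index \<open>k = 0\<close>, the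
  functions with a jump at \<open>a\<close>, are left out.
\<close>

primrec pairing_term :: "'k \<Rightarrow> 'f \<Rightarrow> 'k dist_basis \<Rightarrow> 'f \<Rightarrow> 'f" where
  "pairing_term a g B1 f = 0"
| "pairing_term a g (BH c k) f =
     (if c = a \<and> k > 0 then (- 1) ^ (k - 1) * ev_at F a ((der F ^^ (k - 1)) (f * g)) else 0)"

abbreviation "pairing a g \<equiv> sum_terms (pairing_term a g)"

lemma additive_der_funpow: "additive (der F ^^ n)"
  by (induction n) (unfold_locales, simp_all add: additive.add)

lemma der_funpow_const_mult:
  assumes "der F h = 0"
  shows "(der F ^^ n) (h * g) = h * (der F ^^ n) g"
  by (induction n) (simp_all add: assms der_mult)

lemma additive_pairing_term: "additive (pairing_term a g b)"
  by (cases b; unfold_locales)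
    (simp_all add: distrib_right distrib_left additive.add[OF additive_der_funpow])

lemma additive_pairing: "additive (pairing a g)"
  by (intro additive_sum_terms additive_pairing_term)

lemmas pairing_simps [simp] = additive.add[OF additive_pairing] additive.diff[OF additive_pairing]
  additive.minus[OF additive_pairing] additive.zero[OF additive_pairing]

lemma pairing_monomial [simp]: "pairing a g (f \<diamondop> b) = pairing_term a g b f"
  by (rule sum_terms_single, rule additive_pairing_term)

lemma pairing_smult: "pairing a g (f \<cdot> p) = pairing a (f * g) p"
proof (induction p rule: poly_mapping_single_induct)
  case (single b h)
  show ?case by (cases b) (simp_all add: ac_simps)
qed simp

text \<open>
  For a distribution \<open>f \<delta>\<^sub>a\<^sup>(\<^sup>k\<^sup>)\<close> the terms with \<open>f'\<close> cancel by the Leibniz rule under \<open>\<e>\<^sub>a\<close>. The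
  boundary term comes from the jump of \<open>f H\<^sub>a\<close>, whose derivative contains \<open>f \<delta>\<^sub>a\<close>.
\<close>

lemma pairing_free_D:
  "pairing a g (free_D p) = ev_at F a (Poly_Mapping.lookup p (BH a 0) * g) - pairing a (der F g) p"
proof (induction p rule: poly_mapping_single_induct)
  case (single b h)
  show ?case
  proof (cases b)
    case B1
    then show ?thesis by (simp add: lookup_single)
  next
    case (BH c k)
    show ?thesis
      by (cases k)
        (auto simp: BH lookup_single when_def der_mult funpow_swap1
          additive.add[OF additive_der_funpow] algebra_simps)
  qed
qed (simp add: lookup_add distrib_right)

lemma lookup_free_D_B1: "Poly_Mapping.lookup (free_D p) B1 = der F (Poly_Mapping.lookup p B1)"
proof (induction p rule: poly_mapping_single_induct)
  case (single b h)
  show ?case by (cases b) (simp_all add: lookup_single lookup_add when_def)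
qed (simp add: lookup_add)

lemma lookup_free_D_BH_0:
  "Poly_Mapping.lookup (free_D p) (BH a 0) = der F (Poly_Mapping.lookup p (BH a 0))"
proof (induction p rule: poly_mapping_single_induct)
  case (single b h)
  show ?case by (cases b) (simp_all add: lookup_single lookup_add when_def)
qed (simp add: lookup_add)

definition annihilator :: "('k, 'f) pre_dist set" where
  "annihilator = {p. Poly_Mapping.lookup p B1 = 0 \<and>
     (\<forall>a. Poly_Mapping.lookup p (BH a 0) = 0) \<and> (\<forall>a g. pairing a g p = 0)}"

text \<open>
  The pairings kill the generators since \<open>\<e>\<^sub>a(f g) = \<e>\<^sub>a(f) \<e>\<^sub>a(g)\<close>. Taking all test functions at
  once makes the annihilator stable under multiplication, which moves to the test function, and
  under the derivation.
\<close>

lemma Z_subset_annihilator: "Z \<subseteq> annihilator"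
proof (rule relations_least; unfold annihilator_def mem_Collect_eq)
  fix a f
  let ?p = "f \<diamondop> BH a (Suc 0) - ev_at F a f \<diamondop> BH a (Suc 0)"
  show "Poly_Mapping.lookup ?p B1 = 0 \<and> (\<forall>a. Poly_Mapping.lookup ?p (BH a 0) = 0) \<and>
      (\<forall>c g. pairing c g ?p = 0)"
    by (simp add: lookup_minus lookup_single ev_at_mult ev_at_const)
qed (simp_all add: lookup_add pairing_smult pairing_free_D lookup_free_D_B1 lookup_free_D_BH_0)


text \<open>
  The other inclusion rests on a normal form: modulo \<open>Z\<close>, distributions supported in points have
  constant coefficients. Closure under the derivation is what reduces \<open>f \<delta>\<^sub>a\<^sup>(\<^sup>k\<^sup>+\<^sup>1\<^sup>)\<close>, which is
  \<open>D(f \<delta>\<^sub>a\<^sup>(\<^sup>k\<^sup>)) - f' \<delta>\<^sub>a\<^sup>(\<^sup>k\<^sup>)\<close>, to lower order.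
\<close>

definition const_coeffs_mod_Z :: "('k, 'f) pre_dist \<Rightarrow> bool" where
  "const_coeffs_mod_Z p \<longleftrightarrow> (\<exists>q. p - q \<in> Z \<and> (\<forall>b. der F (Poly_Mapping.lookup q b) = 0))"

lemma const_coeffs_mod_Z_add:
  "const_coeffs_mod_Z p \<Longrightarrow> const_coeffs_mod_Z p' \<Longrightarrow> const_coeffs_mod_Z (p + p')"
proof -
  assume "const_coeffs_mod_Z p" "const_coeffs_mod_Z p'"
  then obtain q q' where q: "p - q \<in> Z" "\<forall>b. der F (Poly_Mapping.lookup q b) = 0"
    and q': "p' - q' \<in> Z" "\<forall>b. der F (Poly_Mapping.lookup q' b) = 0"
    unfolding const_coeffs_mod_Z_def by blast
  have "p + p' - (q + q') = (p - q) + (p' - q')" by simp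
  then have "p + p' - (q + q') \<in> Z" using add_in_Z q q' by metis
  then show ?thesis
    using q q' unfolding const_coeffs_mod_Z_def by (metis lookup_add der_simps(1) add_0)
qed

lemma const_coeffs_mod_Z_minus: "const_coeffs_mod_Z p \<Longrightarrow> const_coeffs_mod_Z (- p)"
proof -
  assume "const_coeffs_mod_Z p"
  then obtain q where q: "p - q \<in> Z" "\<forall>b. der F (Poly_Mapping.lookup q b) = 0"
    unfolding const_coeffs_mod_Z_def by blast
  have "- p - - q = - (p - q)" by simp
  then have "- p - - q \<in> Z" using minus_in_Z q by metis
  then show ?thesis
    using q unfolding const_coeffs_mod_Z_def by (metis lookup_uminus der_simps(3) minus_zero)
qed

lemma const_coeffs_mod_Z_free_D: "const_coeffs_mod_Z p \<Longrightarrow> const_coeffs_mod_Z (free_D p)"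
proof -
  assume "const_coeffs_mod_Z p"
  then obtain q where q: "p - q \<in> Z" "\<forall>b. der F (Poly_Mapping.lookup q b) = 0"
    unfolding const_coeffs_mod_Z_def by blast
  have "free_D p - free_D q \<in> Z" using free_D_in_Z[OF q(1)] by simp
  moreover have "der F (Poly_Mapping.lookup (free_D q) b) = 0" for b
  proof -
    have "der F (Poly_Mapping.lookup (der_term F b' (Poly_Mapping.lookup q b')) b) = 0" for b'
      using q(2) by (cases b') (simp_all add: lookup_add lookup_single when_def)
    then show ?thesis
      by (simp add: extend_def lookup_sum additive.sum[OF additive_der])
  qed
  ultimately show ?thesis unfolding const_coeffs_mod_Z_def by blast
qed

lemma const_coeffs_mod_Z_delta: "const_coeffs_mod_Z (f \<diamondop> BH a (Suc k))"
proof (induction k arbitrary: f)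
  case 0
  show ?case unfolding const_coeffs_mod_Z_def
    using delta_in_Z[of a f]
    by (intro exI[of _ "ev_at F a f \<diamondop> BH a (Suc 0)"]) (simp add: lookup_single when_def)
next
  case (Suc k)
  have "f \<diamondop> BH a (Suc (Suc k)) = free_D (f \<diamondop> BH a (Suc k)) + - (der F f \<diamondop> BH a (Suc k))"
    by simp
  then show ?case
    using const_coeffs_mod_Z_add const_coeffs_mod_Z_free_D const_coeffs_mod_Z_minus Suc by metis
qed

lemma const_coeffs_mod_Z_delta_part:
  assumes "Poly_Mapping.lookup p B1 = 0" and "\<And>a. Poly_Mapping.lookup p (BH a 0) = 0"
  shows "const_coeffs_mod_Z p"
proof -
  have "const_coeffs_mod_Z (\<Sum>b\<in>B. Poly_Mapping.lookup p b \<diamondop> b)" if "finite B" for B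
    using that
  proof induction
    case empty
    show ?case unfolding const_coeffs_mod_Z_def by (intro exI[of _ 0]) simp
  next
    case (insert b B)
    have "const_coeffs_mod_Z (Poly_Mapping.lookup p b \<diamondop> b)"
    proof (cases "Poly_Mapping.lookup p b = 0")
      case True
      then show ?thesis unfolding const_coeffs_mod_Z_def by (intro exI[of _ 0]) simp
    next
      case False
      then obtain a k where "b = BH a (Suc k)"
        using assms by (metis dist_basis.exhaust not0_implies_Suc)
      then show ?thesis by (simp add: const_coeffs_mod_Z_delta)
    qed
    then show ?case using insert by (simp add: const_coeffs_mod_Z_add)
  qed
  then show ?thesis
    by (subst poly_mapping_eq_sum_single) simp
qed

text \<open>
  The divided power \<open>(x - a)\<^sup>n / n!\<close>, obtained by moving the iterated integral of 1 from 0 to \<open>a\<close>.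
  Its derivatives at \<open>a\<close> are dual to the derivatives of \<open>\<delta>\<^sub>a\<close>.
\<close>

definition test_monomial :: "'k \<Rightarrow> nat \<Rightarrow> 'f" where
  "test_monomial a n = shft F (- a) ((integ F ^^ n) 1)"

lemma ev_at_der_funpow_test_monomial:
  "ev_at F a ((der F ^^ k) (test_monomial a n)) = (if k = n then 1 else 0)"
proof -
  have "(der F ^^ k) (shft F (- a) f) = shft F (- a) ((der F ^^ k) f)" for f
    by (induction k) (simp_all add: der_shft)
  then have "ev_at F a ((der F ^^ k) (test_monomial a n)) = ev F ((der F ^^ k) ((integ F ^^ n) 1))"
    by (simp add: test_monomial_def ev_at_shft ev_at_0)
  also have "\<dots> = (if k = n then 1 else 0)"
  proof (induction n arbitrary: k)
    case 0
    have "(der F ^^ Suc j) 1 = 0" for j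
      by (induction j) simp_all
    then show ?case by (cases k) (simp_all add: ev_const del: funpow.simps)
  next
    case (Suc n)
    have "(der F ^^ Suc j) (integ F g) = (der F ^^ j) g" for j g
      by (simp add: funpow_swap1 der_integ)
    with Suc show ?case
      by (cases k) (simp_all del: funpow.simps(2) add: funpow.simps(2)[of _ "integ F"])
  qed
  finally show ?thesis .
qed

lemma pairing_test_monomial:
  assumes "\<And>b. der F (Poly_Mapping.lookup q b) = 0"
  shows "pairing a (test_monomial a n) q = (- 1) ^ n * Poly_Mapping.lookup q (BH a (Suc n))"
proof -
  have "pairing_term a (test_monomial a n) b (Poly_Mapping.lookup q b) =
      (if b = BH a (Suc n) then (- 1) ^ n * Poly_Mapping.lookup q b else 0)" for b
  proof (cases b)
    case (BH c k)
    show ?thesis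
      using assms[of b] by (cases k)
        (auto simp: BH der_funpow_const_mult ev_at_mult ev_at_const ev_at_der_funpow_test_monomial)
  qed simp
  then show ?thesis
    by (simp add: sum_terms_def sum.delta in_keys_iff)
qed

lemma annihilator_subset_Z: "annihilator \<subseteq> Z"
proof
  fix p assume p: "p \<in> annihilator"
  then obtain q where q: "p - q \<in> Z" "\<And>b. der F (Poly_Mapping.lookup q b) = 0"
    using const_coeffs_mod_Z_delta_part[of p] unfolding annihilator_def const_coeffs_mod_Z_def by auto
  have "p - q \<in> annihilator" using q(1) Z_subset_annihilator by blast
  then have q0: "Poly_Mapping.lookup q B1 = 0" "\<And>a. Poly_Mapping.lookup q (BH a 0) = 0"
    "\<And>a g. pairing a g q = 0"
    using p by (auto simp: annihilator_def lookup_minus)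
  have "(- 1) ^ n * Poly_Mapping.lookup q (BH a (Suc n)) = 0" for a n
    using q0(3)[of a "test_monomial a n"] pairing_test_monomial[OF q(2)] by simp
  then have "Poly_Mapping.lookup q (BH a (Suc n)) = 0" for a n
    by (metis (no_types) left_minus_one_mult_self mult_zero_right)
  then have "Poly_Mapping.lookup q b = 0" for b
    using q0(1,2) by (metis dist_basis.exhaust not0_implies_Suc)
  then have "q = 0" by (intro poly_mapping_eqI) simp
  then show "p \<in> Z" using q(1) by simp
qed

lemma Z_eq_annihilator: "Z = annihilator"
  using Z_subset_annihilator annihilator_subset_Z by blast

lemma pairing_zero_test [simp]: "pairing a 0 p = 0"
proof -
  have "pairing_term a 0 b f = 0" for b f
    by (cases b) (simp_all add: additive.zero[OF additive_der_funpow])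
  then show ?thesis by (simp add: sum_terms_def)
qed

text \<open>
  The test function \<open>g = 1\<close> shows that the constant coefficient at \<open>H\<^sub>a\<close> vanishes, and \<open>\<integral>g\<close> that
  the pairing with \<open>g\<close> does.
\<close>

lemma kernel_free_D_modulo_Z:
  assumes "free_D p \<in> Z"
  obtains c where "p - const_of F c \<diamondop> B1 \<in> Z"
proof -
  have D: "der F (Poly_Mapping.lookup p B1) = 0" "\<And>a. der F (Poly_Mapping.lookup p (BH a 0)) = 0"
    "\<And>a g. ev_at F a (Poly_Mapping.lookup p (BH a 0) * g) = pairing a (der F g) p"
    using assms
    by (simp_all add: Z_eq_annihilator annihilator_def lookup_free_D_B1 lookup_free_D_BH_0 pairing_free_D)
  have H: "Poly_Mapping.lookup p (BH a 0) = 0" for a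
    using D(3)[of a 1] by (simp add: ev_at_const D(2))
  have pairing: "pairing a g p = 0" for a g
    using D(3)[of a "integ F g"] by (simp add: H der_integ)
  obtain c where c: "Poly_Mapping.lookup p B1 = const_of F c"
    using D(1) by (rule constE)
  have "p - const_of F c \<diamondop> B1 \<in> annihilator"
    by (simp add: annihilator_def lookup_minus lookup_single H c pairing)
  then show thesis using that Z_eq_annihilator by blast
qed

section \<open>Integration modulo the relations\<close>

text \<open>
  The relations enter at two places: \<open>(\<integral>\<^sub>a f) \<delta>\<^sub>a\<close> is zero as \<open>\<integral>\<^sub>a f\<close> vanishes at \<open>a\<close>, and
  \<open>\<e>\<^sub>a(f) \<delta>\<^sub>a = f \<delta>\<^sub>a\<close>.
\<close>

lemma free_D_free_I_modulo_Z: "free_D (free_I p) - p \<in> Z"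
proof (induction p rule: poly_mapping_single_induct)
  case (single b f)
  show ?case
  proof (cases b)
    case B1
    then show ?thesis by (simp add: der_integ)
  next
    case (BH a k)
    have "free_D (integ_heaviside_term F a k f) - f \<diamondop> BH a k \<in> Z"
    proof (induction k arbitrary: f)
      case 0
      have "ev_at F a (integ_from F a f) = 0"
        by (simp add: integ_from_eq ev_at_const)
      then show ?case
        using delta_in_Z[of a "integ_from F a f"]
        by (simp add: integ_from_eq integ_from_to_eq scal_eq_const_mult der_mult der_integ)
    next
      case (Suc k)
      show ?case
      proof (cases k)
        case 0
        then show ?thesis
          using minus_in_Z[OF delta_in_Z[of a f]] by (simp add: scal_eq_const_mult der_mult)
      next
        case (Suc j)
        then show ?thesis
          using minus_in_Z[OF Suc.IH[of "der F f"]] by simp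
      qed
    qed
    then show ?thesis by (simp add: BH)
  qed
next
  case (add p q)
  have "free_D (free_I (p + q)) - (p + q) = (free_D (free_I p) - p) + (free_D (free_I q) - q)" by simp
  then show ?case by (simp only: add_in_Z[OF add])
qed

lemma free_E_eq_0_if_in_Z: "p \<in> Z \<Longrightarrow> free_E p = 0"
proof -
  assume p: "p \<in> Z"
  have "ev_term b (Poly_Mapping.lookup p b) = 0" for b
    using p by (cases b) (simp_all add: Z_eq_annihilator annihilator_def)
  then show ?thesis by (simp add: sum_terms_def)
qed

text \<open>
  The element \<open>I p\<close> has derivative \<open>p\<close> modulo \<open>Z\<close>, so it is a constant modulo \<open>Z\<close>. The functional
  \<open>free_E\<close> detects constants and vanishes on the image of \<open>I\<close>.
\<close>

lemma free_I_in_Z: "p \<in> Z \<Longrightarrow> free_I p \<in> Z"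
proof -
  assume p: "p \<in> Z"
  have "free_D (free_I p) = (free_D (free_I p) - p) + p" by simp
  then have "free_D (free_I p) \<in> Z" using add_in_Z[OF free_D_free_I_modulo_Z[of p] p] by simp
  then obtain c where c: "free_I p - const_of F c \<diamondop> B1 \<in> Z" by (rule kernel_free_D_modulo_Z)
  then have "const_of F c = 0"
    using free_E_eq_0_if_in_Z[OF c] by (simp add: ev_const)
  then show ?thesis using c by simp
qed


section \<open>The quotient module\<close>

abbreviation "DF \<equiv> dist_module F"
abbreviation "cls \<equiv> dist_class F"

lemma mem_cls_iff: "q \<in> cls p \<longleftrightarrow> q - p \<in> Z"
  by (force simp: dist_class_def a_r_coset_def')

lemma cls_eq_iff: "cls p = cls q \<longleftrightarrow> p - q \<in> Z"
proof
  assume "cls p = cls q"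
  then show "p - q \<in> Z" using mem_cls_iff[of p p] mem_cls_iff[of p q] by simp
next
  assume pq: "p - q \<in> Z"
  have "r - p \<in> Z \<longleftrightarrow> r - q \<in> Z" for r
    using add_in_Z[OF _ pq, of "r - p"] diff_in_Z[OF _ pq, of "r - q"] by auto
  then show "cls p = cls q" by (auto simp: mem_cls_iff)
qed

text \<open>
  The maps of a quotient module are unions of cosets over all representatives; they are single
  cosets as soon as the result is independent of the representative.
\<close>

lemma UN_cls_const:
  assumes "\<And>q. q \<in> cls p \<Longrightarrow> cls (T q) = C"
  shows "(\<Union>q\<in>cls p. dist_relations F +>\<^bsub>free_dist\<^esub> T q) = C"
proof -
  have "p \<in> cls p" by (simp add: mem_cls_iff)
  then show ?thesis using assms by (auto simp flip: dist_class_def)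
qed

lemma induced_map_cls:
  assumes "additive T" and "\<And>p. p \<in> Z \<Longrightarrow> T p \<in> Z"
  shows "induced_map free_dist Z T (cls p) = cls (T p)"
  unfolding induced_map_def
proof (rule UN_cls_const)
  fix q assume "q \<in> cls p"
  then show "cls (T q) = cls (T p)"
    using assms(2)[of "q - p"] by (simp add: mem_cls_iff cls_eq_iff additive.diff[OF assms(1)])
qed

lemma dist_D_cls [simp]: "dist_D F (cls p) = cls (free_D p)"
  and dist_I_cls [simp]: "dist_I F (cls p) = cls (free_I p)"
  and dist_S_cls [simp]: "dist_S F c (cls p) = cls (free_S c p)"
  by (simp_all add: dist_D_def dist_I_def dist_S_def induced_map_cls additive_free_D additive_free_I
      additive_free_S free_D_in_Z free_I_in_Z free_S_in_Z)

lemma carrier_dist [simp]: "carrier DF = range cls"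
  by (auto simp: dist_module_def quotient_module_def A_RCOSETS_def' dist_class_def)

lemma add_dist [simp]: "cls p \<oplus>\<^bsub>DF\<^esub> cls q = cls (p + q)"
proof -
  have "r \<in> cls p <+>\<^bsub>free_dist\<^esub> cls q \<longleftrightarrow> r \<in> cls (p + q)" for r
  proof
    assume "r \<in> cls p <+>\<^bsub>free_dist\<^esub> cls q"
    then obtain x y where "r = x + y" "x - p \<in> Z" "y - q \<in> Z"
      by (auto simp: set_add_def' mem_cls_iff)
    moreover have "x + y - (p + q) = (x - p) + (y - q)" by simp
    ultimately show "r \<in> cls (p + q)" by (simp only: mem_cls_iff add_in_Z)
  next
    assume "r \<in> cls (p + q)"
    then have "r - q \<in> cls p" by (simp add: mem_cls_iff algebra_simps)
    moreover have "q \<in> cls q" by (simp add: mem_cls_iff)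
    ultimately show "r \<in> cls p <+>\<^bsub>free_dist\<^esub> cls q"
      by (force simp: set_add_def')
  qed
  then show ?thesis by (auto simp: dist_module_def quotient_module_def)
qed

lemma smult_dist [simp]: "f \<odot>\<^bsub>DF\<^esub> cls p = cls (f \<cdot> p)"
proof -
  have "(\<Union>q\<in>cls p. dist_relations F +>\<^bsub>free_dist\<^esub> (f \<cdot> q)) = cls (f \<cdot> p)"
  proof (rule UN_cls_const)
    fix q assume "q \<in> cls p"
    then show "cls (f \<cdot> q) = cls (f \<cdot> p)"
      using smult_in_Z[of "q - p" f] by (simp add: mem_cls_iff cls_eq_iff)
  qed
  then show ?thesis by (simp add: dist_module_def quotient_module_def)
qed

lemma zero_dist [simp]: "\<zero>\<^bsub>DF\<^esub> = cls 0"
  by (auto simp: dist_module_def quotient_module_def mem_cls_iff)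

lemma module_dist: "Module.module ring_of_type_algebra DF"
proof (rule moduleI)
  show "cring (ring_of_type_algebra :: 'f ring)" by (rule cring_from_type_algebra)
  show "abelian_group DF"
  proof (rule abelian_groupI)
    fix x assume "x \<in> carrier DF"
    then obtain p where "x = cls p" by auto
    then have "cls (- p) \<oplus>\<^bsub>DF\<^esub> x = \<zero>\<^bsub>DF\<^esub>" by simp
    then show "\<exists>y\<in>carrier DF. y \<oplus>\<^bsub>DF\<^esub> x = \<zero>\<^bsub>DF\<^esub>"
      by (metis carrier_dist rangeI)
  qed (auto simp: add_ac)
qed (auto simp: ring_of_type_algebra_def smult_add_left smult_smult)

lemma minus_dist [simp]: "cls p \<ominus>\<^bsub>DF\<^esub> cls q = cls (p - q)"
proof -
  interpret Module.module ring_of_type_algebra DF by (rule module_dist)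
  have "\<ominus>\<^bsub>DF\<^esub> cls q = cls (- q)"
    by (rule minus_equality) auto
  then show ?thesis by (simp add: a_minus_def)
qed

lemma dist_one_eq: "dist_one F = cls (1 \<diamondop> B1)"
  and dist_H_eq: "dist_H F a = cls (1 \<diamondop> BH a 0)"
  and dist_delta_eq: "dist_delta F a k = cls (1 \<diamondop> BH a (Suc k))"
  by (simp_all add: dist_one_def dist_H_def dist_delta_def)

lemma dist_const_eq: "dist_const F c = cls (const_of F c \<diamondop> B1)"
  by (simp add: dist_const_def dist_one_eq)

lemma mod_ev_cls [simp]: "mod_ev DF (dist_D F) (dist_I F) (cls p) = cls (free_E p \<diamondop> B1)"
  by (simp add: mod_ev_def monomial_free_E_eq)

lemma dist_I_from_cls:
  "dist_I_from F b (cls p) = cls (free_I p - free_E (free_S b (free_I p)) \<diamondop> B1)"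
  by (simp add: dist_I_from_def mod_integ_from_def mod_ev_at_def)

lemma linear_over_field_dist:
  assumes "additive T" and "\<And>c p. T (const_of F c \<cdot> p) = const_of F c \<cdot> T p"
    and "\<And>p. t (cls p) = cls (T p)"
  shows "linear_over_field F DF t"
  by (auto simp: linear_over_field_def assms(2,3) additive.add[OF assms(1)])

theorem dist_module_ordinary_shifted:
  "ordinary_shifted_integro_differential_module F DF
     (dist_D F) (dist_I F) (dist_one F) (dist_S F)"
proof -
  interpret M: Module.module ring_of_type_algebra DF by (rule module_dist)
  have linear: "linear_over_field F DF (dist_D F)" "linear_over_field F DF (dist_I F)"
    "linear_over_field F DF (dist_S F c)" for c
    by (rule linear_over_field_dist[OF additive_free_D] linear_over_field_dist[OF additive_free_I]
        linear_over_field_dist[OF additive_free_S];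
        simp add: free_D_smult free_I_const_smult free_S_smult)+
  have rota_baxter:
    "cls (integ F f \<cdot> free_I p) = cls (free_I (f \<cdot> free_I p) + free_I (integ F f \<cdot> p))" for f p
  proof -
    \<comment> \<open>The product \<open>?y\<close> has evaluation zero because \<open>\<e>\<close> kills integrals, so it is the integral of its
      own derivative; expanding that derivative by the Leibniz rule gives the identity.\<close>
    let ?y = "integ F f \<cdot> free_I p"
    have "?y = free_I (free_D ?y)"
      using monomial_free_E_eq[of ?y] by (simp add: free_E_smult)
    also have "\<dots> = free_I (f \<cdot> free_I p) + free_I (integ F f \<cdot> free_D (free_I p))"
      by (simp add: free_D_smult der_integ)
    finally have "?y - (free_I (f \<cdot> free_I p) + free_I (integ F f \<cdot> p)) =
        free_I (integ F f \<cdot> (free_D (free_I p) - p))"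
      by simp
    then show ?thesis
      by (simp only: cls_eq_iff free_I_in_Z smult_in_Z free_D_free_I_modulo_Z)
  qed
  have shift: "cls (free_S c (free_I p) - free_I (free_S c p)) =
      cls (free_E (free_S c (free_I p)) \<diamondop> B1)" for c p
  proof -
    \<comment> \<open>The evaluation \<open>1 - I D\<close> of \<open>S\<^sub>c I p\<close>, rewritten by \<open>D S\<^sub>c = S\<^sub>c D\<close> and \<open>D I = 1\<close>.\<close>
    have "free_S c (free_I p) - free_I (free_S c p) - free_E (free_S c (free_I p)) \<diamondop> B1 =
        free_I (free_S c (free_D (free_I p) - p))"
      by (simp add: monomial_free_E_eq free_S_free_D)
    then show ?thesis
      by (simp only: cls_eq_iff free_I_in_Z free_S_in_Z free_D_free_I_modulo_Z)
  qed
  have D_I: "cls (free_D (free_I p)) = cls p" for p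
    by (simp add: cls_eq_iff free_D_free_I_modulo_Z)
  have embedding: "inj (\<lambda>c. const_of F c \<odot>\<^bsub>DF\<^esub> dist_one F)"
  proof (rule injI)
    fix c d assume "const_of F c \<odot>\<^bsub>DF\<^esub> dist_one F = const_of F d \<odot>\<^bsub>DF\<^esub> dist_one F"
    then have "const_of F (c - d) \<diamondop> B1 \<in> annihilator"
      by (simp add: dist_one_eq cls_eq_iff Z_eq_annihilator const_of_diff monomial_diff)
    then show "c = d" by (simp add: annihilator_def)
  qed
  have kernel: "{x \<in> carrier DF. dist_D F x = \<zero>\<^bsub>DF\<^esub>} =
      range (\<lambda>c. const_of F c \<odot>\<^bsub>DF\<^esub> dist_one F)"
  proof (intro equalityI subsetI)
    fix x assume "x \<in> {x \<in> carrier DF. dist_D F x = \<zero>\<^bsub>DF\<^esub>}"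
    then obtain p where p: "x = cls p" and "cls (free_D p) = cls 0" by auto
    then have "free_D p \<in> Z" by (simp add: cls_eq_iff)
    then obtain c where "p - const_of F c \<diamondop> B1 \<in> Z" using kernel_free_D_modulo_Z by blast
    then have "x = const_of F c \<odot>\<^bsub>DF\<^esub> dist_one F" by (simp add: p dist_one_eq cls_eq_iff)
    then show "x \<in> range (\<lambda>c. const_of F c \<odot>\<^bsub>DF\<^esub> dist_one F)" by blast
  qed (auto simp: dist_one_eq)
  have bij: "bij_betw (dist_S F c) (carrier DF) (carrier DF)" for c
    by (rule bij_betw_byWitness[where f' = "dist_S F (- c)"]) (auto simp: free_S_free_S)
  show ?thesis
  proof unfold_locales
  qed (use embedding kernel bij linear in
      \<open>auto simp: dist_one_eq D_I free_D_smult rota_baxter free_E_smult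
          free_S_free_S free_S_smult free_S_free_D shift mod_ev_at_def\<close>)
qed

text \<open>
  Both cases hold before passing to cosets: \<open>I(f \<delta>\<^sub>a)\<close> depends on \<open>f\<close> only through the constant
  factor \<open>\<e>\<^sub>a(f)\<close>, and the correction term \<open>\<E>\<^sub>b(f \<delta>\<^sub>a\<^sup>(\<^sup>k\<^sup>-\<^sup>1\<^sup>))\<close> is zero.
\<close>

theorem dist_I_from_recursion:
  "dist_I_from F b (f \<odot>\<^bsub>DF\<^esub> dist_delta F a k) =
     (if k = 0 then ev_at F a f \<odot>\<^bsub>DF\<^esub> dist_I_from F b (dist_delta F a 0)
      else (f \<odot>\<^bsub>DF\<^esub> dist_delta F a (k - 1)) \<ominus>\<^bsub>DF\<^esub>
           dist_I_from F b (der F f \<odot>\<^bsub>DF\<^esub> dist_delta F a (k - 1)))"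
proof (cases k)
  case 0
  have "free_I (f \<diamondop> BH a (Suc 0)) = ev_at F a f \<cdot> free_I (1 \<diamondop> BH a (Suc 0))"
    by (simp add: scal_eq_const_mult ev_at_const mult.commute)
  moreover have "free_E (free_S b (ev_at F a f \<cdot> p)) = ev_at F a f * free_E (free_S b p)" for p
    by (simp add: free_S_smult free_E_smult shft_const ev_const)
  ultimately show ?thesis
    by (simp only: 0 dist_delta_eq smult_dist smult_monomial mult_1_right dist_I_from_cls if_True
        smult_simps cls_eq_iff)
       (simp add: cls_eq_iff)
next
  case (Suc j)
  then show ?thesis
    by (simp add: dist_delta_eq dist_I_from_cls monomial_minus algebra_simps)
qed

lemma dist_I_from_delta:
  "dist_I_from F b (dist_delta F a 0) =
     cls (1 \<diamondop> BH a 0 - const_of F (heaviside_bar (a - b)) \<diamondop> B1)"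
  by (simp add: dist_delta_eq dist_I_from_cls scal_eq_const_mult ev_at_const ev_const monomial_diff)

end

theorem theorem18:
  fixes F :: "('k::linordered_field, 'f::comm_ring_1) shifted_ops"
  assumes "ordinary_shifted_integro_differential_algebra F"
  shows "ordinary_shifted_integro_differential_module F
           (dist_module F) (dist_D F) (dist_I F) (dist_one F) (dist_S F) \<and>
         (\<forall>b f a k.
            dist_I_from F b (f \<odot>\<^bsub>dist_module F\<^esub> dist_delta F a k) =
              (if k = 0 then ev_at F a f \<odot>\<^bsub>dist_module F\<^esub> dist_I_from F b (dist_delta F a 0)
               else (f \<odot>\<^bsub>dist_module F\<^esub> dist_delta F a (k - 1)) \<ominus>\<^bsub>dist_module F\<^esub>
                    dist_I_from F b (der F f \<odot>\<^bsub>dist_module F\<^esub> dist_delta F a (k - 1)))) \<and>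
         (\<forall>b a.
            dist_I_from F b (dist_delta F a 0) =
              dist_H F a \<ominus>\<^bsub>dist_module F\<^esub> dist_const F (heaviside_bar (a - b)) \<and>
            dist_I_from F b (dist_delta F a 0) =
              dist_const F (heaviside (a - b)) \<ominus>\<^bsub>dist_module F\<^esub> dist_H_bar F a)"
proof -
  interpret shifted_algebra F
    using assms by (simp add: shifted_algebra_def)
  have "dist_I_from F b (dist_delta F a 0) =
        dist_H F a \<ominus>\<^bsub>dist_module F\<^esub> dist_const F (heaviside_bar (a - b))" for a b
    by (simp add: dist_I_from_delta dist_H_eq dist_const_eq)
  moreover have "dist_I_from F b (dist_delta F a 0) =
        dist_const F (heaviside (a - b)) \<ominus>\<^bsub>dist_module F\<^esub> dist_H_bar F a" for a b
    by (simp add: dist_I_from_delta dist_H_bar_def dist_one_eq dist_H_eq dist_const_eq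
        heaviside_bar_def const_of_diff monomial_diff algebra_simps)
  ultimately show ?thesis
    using dist_module_ordinary_shifted dist_I_from_recursion by blast
qed

end
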